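(* Let $\vartheta$ satisfy $\vartheta''>0$ and put $v=\vartheta'$, with inverse function $u(\cdot)$. Let $\eta$ be a convex entropy. For $u^-,u^+\in[m,M]$ and $v^\pm=v(u^\pm)$ let $$\beta(u^-,u^+)=\frac12\int_0^1\frac{u(\theta v^++(1-\theta)v^-)-u^-}{u^+-u^-}\,d\theta,\qquad\overline\eta(u^-,u^+)=\int_0^1\eta\circ u\big(\theta v^++(1-\theta)v^-\big)d\theta.$$ Then $$\overline\eta(u^-,u^+)-\eta(u^-)\le2\beta(u^-,u^+)\big(\eta(u^+)-\eta(u^-)\big).$$
   Context: $m\le M$ are real numbers. Since $\vartheta''>0$, $v=\vartheta'$ is strictly increasing, hence invertible; $u(\cdot)$ denotes the inverse map $v\mapsto u(v)$. When $u^+=u^-=u$, the quotient in $\beta$ is understood as its limit $\theta$, so $\beta(u,u)=\frac14$. *)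

theory Defs
  imports "HOL-Analysis.Analysis"
begin

text \<open>
  Throughout, I is the interval on which the function \<open>\<vartheta>\<close> is given and \<open>v\<close> is its derivative
  on I, so the inverse map \<open>v \<mapsto> u(v)\<close> is \<open>inv_into I v\<close>. It is only ever evaluated on segments
  joining two values of \<open>v\<close> on I; these lie in the image of I because \<open>v\<close> is continuous there.
  The numbers \<open>a\<close> and \<open>b\<close> stand for \<open>u\<^sup>-\<close> and \<open>u\<^sup>+\<close>.
\<close>

definition u_path :: "real set \<Rightarrow> (real \<Rightarrow> real) \<Rightarrow> real \<Rightarrow> real \<Rightarrow> real \<Rightarrow> real" where
  "u_path I v a b \<theta> = inv_into I v (\<theta> * v b + (1 - \<theta>) * v a)"

text \<open>On the diagonal the quotient is read as its limit \<open>\<theta>\<close>, not as Isabelle's \<open>0 / 0 = 0\<close>.\<close>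

definition beta :: "real set \<Rightarrow> (real \<Rightarrow> real) \<Rightarrow> real \<Rightarrow> real \<Rightarrow> real" where
  "beta I v a b =
     1 / 2 * integral {0..1} (\<lambda>\<theta>. if a = b then \<theta> else (u_path I v a b \<theta> - a) / (b - a))"

definition eta_bar ::
  "real set \<Rightarrow> (real \<Rightarrow> real) \<Rightarrow> (real \<Rightarrow> real) \<Rightarrow> real \<Rightarrow> real \<Rightarrow> real" where
  "eta_bar I v \<eta> a b = integral {0..1} (\<lambda>\<theta>. \<eta> (u_path I v a b \<theta>))"

end

theory Submission
  imports Defs
begin

text \<open>
  The map \<open>u\<close> carries the segment joining \<open>v(a)\<close> and \<open>v(b)\<close> into the segment joining
  \<open>a\<close> and \<open>b\<close>, so \<open>u = (1 - t) a + t b\<close> with \<open>t = (u - a) / (b - a)\<close>. Convexity gives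
  \<open>\<eta>(u) - \<eta>(a) \<le> t (\<eta>(b) - \<eta>(a))\<close>, which is integrated over \<open>\<theta>\<close>. Integrability of
  \<open>\<eta> \<circ> u\<close> needs care, because a convex function may jump at the endpoints of its domain.
\<close>

text \<open>Derivatives within \<open>I\<close> restrict to \<open>{x..y}\<close>, where the mean
  value theorem makes \<open>v y - v x\<close> a positive multiple of \<open>y - x\<close>.
  Injectivity turns \<open>inv_into I v\<close> into a genuine inverse of \<open>v\<close>.\<close>

lemma inj_on_deriv_pos:
  fixes v v' :: "real \<Rightarrow> real"
  assumes "is_interval I"
    and deriv: "\<And>x. x \<in> I \<Longrightarrow> (v has_real_derivative v' x) (at x within I)"
    and pos: "\<And>x. x \<in> I \<Longrightarrow> v' x > 0"
  shows "inj_on v I"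
proof (rule linorder_inj_onI)
  fix x y assume xy: "x < y" "x \<in> I" "y \<in> I"
  have sub: "{x..y} \<subseteq> I"
    using xy \<open>is_interval I\<close> by (meson atLeastAtMost_iff mem_is_interval_1_I subsetI)
  have "(v has_derivative (*) (v' z)) (at z within {x..y})" if "x \<le> z" "z \<le> y" for z
    using has_derivative_subset[OF deriv[unfolded has_field_derivative_def] sub] that sub
    by auto
  then obtain z where z: "z \<in> {x<..<y}" "v y - v x = v' z * (y - x)"
    using mvt_simple[OF \<open>x < y\<close>, of v "\<lambda>z. (*) (v' z)"] by auto
  then have "z \<in> I"
    using sub by (meson atLeastAtMost_iff greaterThanLessThan_iff less_imp_le subsetD)
  then have "v' z * (y - x) > 0"
    using pos \<open>x < y\<close> by simp
  with z(2) show "v x \<noteq> v y"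
    by auto
qed auto

text \<open>The larger endpoint value is an upper bound by convexity; reflection in the midpoint
  converts it into a lower bound. The argument tolerates jumps at the endpoints.\<close>

lemma convex_on_bounded_segment:
  fixes f :: "'a::real_vector \<Rightarrow> real"
  assumes "convex_on S f" and "a \<in> S" and "b \<in> S"
  shows "\<exists>B. \<forall>x \<in> closed_segment a b. \<bar>f x\<bar> \<le> B"
proof -
  define C where "C = max (f a) (f b)"
  define c where "c = f ((1/2) *\<^sub>R a + (1/2) *\<^sub>R b)"
  have upper: "f x \<le> C" if x: "x \<in> closed_segment a b" for x
  proof -
    obtain t where t: "0 \<le> t" "t \<le> 1" "x = (1 - t) *\<^sub>R a + t *\<^sub>R b"
      using x by (metis in_segment(1))
    have "f x \<le> (1 - t) * f a + t * f b"
      using convex_onD[OF assms(1) t(1,2) assms(2,3)] t(3) by simp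
    also have "\<dots> \<le> (1 - t) * C + t * C"
      using t by (intro add_mono mult_left_mono) (auto simp: C_def)
    finally show ?thesis
      by (simp add: algebra_simps)
  qed
  have seg: "closed_segment a b \<subseteq> S"
    using assms convex_on_imp_convex by (metis closed_segment_subset)
  have lower: "2 * c - C \<le> f x" if x: "x \<in> closed_segment a b" for x
  proof -
    obtain t where t: "0 \<le> t" "t \<le> 1" "x = (1 - t) *\<^sub>R a + t *\<^sub>R b"
      using x by (metis in_segment(1))
    \<comment> \<open>The mirror image of \<open>x\<close> in the midpoint: \<open>c\<close> is at
      most the mean of \<open>f x\<close> and \<open>f y\<close>, and
      \<open>f y \<le> C\<close>.\<close>
    define y where "y = t *\<^sub>R a + (1 - t) *\<^sub>R b"
    have y: "y \<in> closed_segment a b"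
      using t by (auto simp: in_segment y_def intro!: exI[of _ "1 - t"])
    have mid: "(1/2) *\<^sub>R x + (1/2) *\<^sub>R y = (1/2) *\<^sub>R a + (1/2) *\<^sub>R b"
      by (simp add: t(3) y_def algebra_simps flip: scaleR_add_left)
    have "c \<le> f x / 2 + f y / 2"
      using convex_onD[OF assms(1), of "1/2" x y] that y seg mid by (auto simp: c_def)
    then show ?thesis
      using upper[OF y] by simp
  qed
  have "\<bar>f x\<bar> \<le> \<bar>C\<bar> + \<bar>2 * c - C\<bar>" if "x \<in> closed_segment a b" for x
    using upper[OF that] lower[OF that] by linarith
  then show ?thesis
    by blast
qed

text \<open>Continuity gives measurability on the open interval, the constant \<open>B\<close>
  dominates, and the two endpoints form a null set.\<close>

lemma integrable_bounded_continuous_Ioo: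
  fixes f :: "real \<Rightarrow> real"
  assumes "continuous_on {a<..<b} f" and "\<And>x. x \<in> {a<..<b} \<Longrightarrow> \<bar>f x\<bar> \<le> B"
  shows "f integrable_on {a..b}"
proof -
  have "f integrable_on {a<..<b}"
  proof (rule measurable_bounded_by_integrable_imp_integrable)
    show "f \<in> borel_measurable (lebesgue_on {a<..<b})"
      using assms(1) by (intro continuous_imp_measurable_on_sets_lebesgue) auto
    show "(\<lambda>_. B) integrable_on {a<..<b}"
      using integrable_const_ivl[of B a b] by (metis integrable_on_Icc_iff_Ioo)
  qed (use assms(2) in auto)
  then show ?thesis
    by (simp add: integrable_on_Icc_iff_Ioo)
qed

theorem lemma2p2:
  fixes I :: "real set" and vartheta v v' \<eta> :: "real \<Rightarrow> real" and m M um up :: real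
  assumes "m \<le> M"
    and "is_interval I" and "{m..M} \<subseteq> I"
    and "\<And>x. x \<in> I \<Longrightarrow> (vartheta has_real_derivative v x) (at x within I)"
    and "\<And>x. x \<in> I \<Longrightarrow> (v has_real_derivative v' x) (at x within I)"
    and "\<And>x. x \<in> I \<Longrightarrow> v' x > 0"
    and "convex_on I \<eta>"
    and "um \<in> {m..M}" and "up \<in> {m..M}"
  shows "eta_bar I v \<eta> um up - \<eta> um \<le> 2 * beta I v um up * (\<eta> up - \<eta> um)"
proof -
  let ?a = um and ?b = up
  let ?w = "u_path I v ?a ?b"
  let ?S = "closed_segment ?a ?b"
  have inj: "inj_on v I"
    using inj_on_deriv_pos assms(2,5,6) by blast
  have ab: "?a \<in> I" "?b \<in> I"
    using assms(3,8,9) by auto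
  show ?thesis
  proof (cases "?a = ?b")
    case True
    \<comment> \<open>On the diagonal the path is constant, so both sides of the inequality are
      0.\<close>
    have "?w \<theta> = ?a" for \<theta>
      using True ab inj by (simp add: u_path_def inv_into_f_f flip: distrib_right)
    then show ?thesis
      using True by (simp add: eta_bar_def)
  next
    case False
    have SI: "?S \<subseteq> I"
      using ab assms(2) by (simp add: closed_segment_subset is_interval_convex_1)
    have cont_v: "continuous_on ?S v"
      using assms(5) SI by (meson DERIV_continuous_on continuous_on_subset)
    have inv: "inv_into I v (v x) = x" if "x \<in> ?S" for x
      using that SI inj by (auto intro: inv_into_f_f)
    \<comment> \<open>A continuous injection on a compact set has a continuous inverse;
      \<open>I\<close> may fail to be compact, hence the restriction to the segment.\<close>
    have cont_inv: "continuous_on (v ` ?S) (inv_into I v)"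
      using continuous_on_inv[OF cont_v compact_segment] inv by blast
    \<comment> \<open>A connected set of reals is convex, so the image contains everything between
      \<open>v um\<close> and \<open>v up\<close>, and the inverse is evaluated only on values that
      \<open>v\<close> takes.\<close>
    have "convex (v ` ?S)"
      using connected_continuous_image[OF cont_v connected_segment]
      by (metis is_interval_connected_1 is_interval_convex_1)
    then have img: "\<theta> * v ?b + (1 - \<theta>) * v ?a \<in> v ` ?S" if "\<theta> \<in> {0..1}" for \<theta>
      using that convexD_alt[of "v ` ?S" "v ?a" "v ?b" \<theta>] by (simp add: add.commute)
    have cont_w: "continuous_on {0..1} ?w"
      unfolding u_path_def
      by (rule continuous_on_compose2[OF cont_inv]) (use img in \<open>auto intro!: continuous_intros\<close>)
    have w: "?w \<theta> \<in> ?S" "v (?w \<theta>) = \<theta> * v ?b + (1 - \<theta>) * v ?a" if "\<theta> \<in> {0..1}" for \<theta>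
      using img[OF that] inv by (auto simp: u_path_def)
    \<comment> \<open>For interior \<open>\<theta>\<close> the value \<open>v (?w \<theta>)\<close>
      differs from \<open>v um\<close> and \<open>v up\<close>, so the path avoids the endpoints,
      where \<open>\<eta>\<close> might jump.\<close>
    have w_open: "?w \<theta> \<in> open_segment ?a ?b" if "\<theta> \<in> {0<..<1}" for \<theta>
    proof -
      have "v ?a \<noteq> v ?b"
        using False inj ab by (auto dest: inj_onD)
      moreover have "v (?w \<theta>) - v ?a = \<theta> * (v ?b - v ?a)"
        "v (?w \<theta>) - v ?b = (1 - \<theta>) * (v ?a - v ?b)"
        using w(2)[of \<theta>] that by (auto simp: algebra_simps)
      ultimately have "v (?w \<theta>) \<noteq> v ?a" "v (?w \<theta>) \<noteq> v ?b"
        using that by auto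
      then show ?thesis
        using w(1)[of \<theta>] that by (auto simp: open_segment_def)
    qed
    \<comment> \<open>Passing to the open segment makes convexity yield continuity.\<close>
    have "convex_on (open_segment ?a ?b) \<eta>"
      using SI segment_open_subset_closed[of ?a ?b]
      by (intro convex_on_subset[OF assms(7)]) auto
    then have cont_\<eta>: "continuous_on (open_segment ?a ?b) \<eta>"
      by (intro convex_on_continuous) (auto simp: open_segment_eq_real_ivl)
    obtain B where B: "\<And>x. x \<in> ?S \<Longrightarrow> \<bar>\<eta> x\<bar> \<le> B"
      using convex_on_bounded_segment[OF assms(7) ab] by blast
    have int_\<eta>: "(\<lambda>\<theta>. \<eta> (?w \<theta>)) integrable_on {0..1}"
    proof (rule integrable_bounded_continuous_Ioo)
      show "continuous_on {0<..<1} (\<lambda>\<theta>. \<eta> (?w \<theta>))"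
        by (rule continuous_on_compose2[OF cont_\<eta> continuous_on_subset[OF cont_w]])
          (use w_open in auto)
      show "\<bar>\<eta> (?w \<theta>)\<bar> \<le> B" if "\<theta> \<in> {0<..<1}" for \<theta>
        using B w(1) that by simp
    qed
    let ?t = "\<lambda>\<theta>. (?w \<theta> - ?a) / (?b - ?a)"
    have int_t: "?t integrable_on {0..1}"
      using False cont_w by (intro integrable_continuous_real continuous_intros) auto
    have "\<eta> (?w \<theta>) \<le> \<eta> ?a + ?t \<theta> * (\<eta> ?b - \<eta> ?a)" if \<theta>: "\<theta> \<in> {0..1}" for \<theta>
    proof -
      obtain t where t: "0 \<le> t" "t \<le> 1" "?w \<theta> = (1 - t) *\<^sub>R ?a + t *\<^sub>R ?b"
        using w(1)[OF \<theta>] by (metis in_segment(1))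
      then have "?w \<theta> - ?a = t * (?b - ?a)"
        by (simp add: algebra_simps)
      then have t_eq: "?t \<theta> = t"
        using False by simp
      have "\<eta> (?w \<theta>) \<le> (1 - t) * \<eta> ?a + t * \<eta> ?b"
        using convex_onD[OF assms(7) t(1,2) ab] t(3) by simp
      then show ?thesis
        unfolding t_eq by (simp add: algebra_simps)
    qed
    then have "eta_bar I v \<eta> ?a ?b \<le> integral {0..1} (\<lambda>\<theta>. \<eta> ?a + ?t \<theta> * (\<eta> ?b - \<eta> ?a))"
      unfolding eta_bar_def using int_t int_\<eta>
      by (intro integral_le integrable_add integrable_on_mult_left) auto
    also have "\<dots> = \<eta> ?a + integral {0..1} ?t * (\<eta> ?b - \<eta> ?a)"
      using integral_add[OF integrable_const_ivl integrable_on_mult_left[OF int_t]] by simp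
    \<comment> \<open>Off the diagonal \<open>?t\<close> is the integrand of \<open>beta\<close>,
      and the 2 cancels its factor \<open>1 / 2\<close>.\<close>
    also have "integral {0..1} ?t = 2 * beta I v ?a ?b"
      unfolding beta_def if_not_P[OF False] by linarith
    finally show ?thesis
      by simp
  qed
qed

end
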